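(* Let $t_0,y_0\in\mathbb{R}$, let $(a_{j,j+1})_{j\ge 0}$ be real numbers with $a_{j,j+1}\neq 0$ for all $j\ge 0$, and let $(c_j)_{j\ge 0}$ be real numbers with $c_0=y_0$. Suppose that $g(t)$ is a real function which is infinitely differentiable at $t=t_0$, and that there exists a function $y(t)$ which is the solution of the initial value problem $$y'(t)=\frac{dy}{dt}=\varphi(y(t))+g(t),\qquad y(t_0)=y_0,$$ for a function $\varphi(y(t))$ which is represented by its Taylor series about $t=t_0$, $$\varphi(y(t))=\sum_{j\ge 1}\left[\prod_{k=0}^{j-1}a_{k,k+1}\right]c_j\,\frac{(t-t_0)^{j-1}}{(j-1)!},$$ on the open interval $|t-t_0|<\delta$ for some real number $\delta>0$. Then the infinite family of functions $x_0,x_1,x_2,\dots$ given by $x_0(t)=y(t)$ and the relations $$x_0'(t)=\varphi(y(t))+g(t)=a_{01}\,x_1(t)+g(t),\qquad x_j'(t)=a_{j,j+1}\,x_{j+1}(t)\quad\text{for all integers } j\ge 1,$$ defines an infinite-dimensional vector function $\mathbf{X}(t)=(x_0(t),x_1(t),x_2(t),x_3(t),\dots)^{T}$ which is the solution of the infinite system of linear ordinary differential equations $$\mathbf{X}'(t)=\mathbf{A}\,\mathbf{X}(t)+\mathbf{b}(t)$$ with the initial vector value $\mathbf{X}(t_0)=(c_0,c_1,c_2,c_3,\dots)^{T}$.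
   Context: Indices of infinite vectors and matrices start at $0$. The infinite matrix $\mathbf{A}=(a_{ij})_{i,j\ge 0}$ has constant real entries: its superdiagonal entries are the given nonzero numbers $a_{j,j+1}$, $j\ge 0$ (that is, $a_{01},a_{12},a_{23},\dots$), and all its other entries are $0$. The infinite vector function $\mathbf{b}(t)$ is $\mathbf{b}(t)=(g(t),0,0,0,\dots)^{T}$. Written out, the equations of the system $\mathbf{X}'=\mathbf{A}\mathbf{X}+\mathbf{b}$ are $x_0'=a_{01}x_1+g$ and $x_j'=a_{j,j+1}x_{j+1}$ for $j\ge 1$. *)

theory Defs
  imports "HOL-Analysis.Analysis"
begin

text \<open>The \<open>n\<close>-th derivative of \<open>g\<close> exists at \<open>t0\<close> for every \<open>n\<close>. As in the usual convention, this
  requires the derivatives of lower order to exist on a neighbourhood of \<open>t0\<close>, which may shrink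
  as \<open>n\<close> grows. Demanding differentiability near \<open>t0\<close>, and not only at \<open>t0\<close>, for each \<open>n\<close>
  keeps junk values of \<open>deriv\<close> from playing any role.\<close>

definition infinitely_differentiable_at :: "(real \<Rightarrow> real) \<Rightarrow> real \<Rightarrow> bool" where
  "infinitely_differentiable_at g t0 \<longleftrightarrow>
     (\<forall>n. \<forall>\<^sub>F t in nhds t0. ((deriv ^^ n) g) differentiable (at t))"

text \<open>Infinite vectors have type \<open>nat \<Rightarrow> real\<close> and infinite matrices \<open>nat \<Rightarrow> nat \<Rightarrow> real\<close> (row index
  first). The series below is a finite sum whenever the rows of the matrix are finitely supported.\<close>

definition inf_mat_vec :: "(nat \<Rightarrow> nat \<Rightarrow> real) \<Rightarrow> (nat \<Rightarrow> real) \<Rightarrow> nat \<Rightarrow> real" where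
  "inf_mat_vec A v = (\<lambda>i. \<Sum>k. A i k * v k)"

definition forcing_vec :: "(real \<Rightarrow> real) \<Rightarrow> real \<Rightarrow> nat \<Rightarrow> real" where
  "forcing_vec g t = (\<lambda>i. if i = 0 then g t else 0)"

text \<open>A solution on \<open>I\<close> of \<open>X' = A X + b\<close>, \<open>X t0 = c\<close>; the derivative of a function with values in
  infinite vectors is taken componentwise.\<close>

definition solves_infinite_linear_ivp ::
  "(nat \<Rightarrow> nat \<Rightarrow> real) \<Rightarrow> (real \<Rightarrow> nat \<Rightarrow> real) \<Rightarrow> real \<Rightarrow> (nat \<Rightarrow> real) \<Rightarrow> real set
     \<Rightarrow> (real \<Rightarrow> nat \<Rightarrow> real) \<Rightarrow> bool" where
  "solves_infinite_linear_ivp A b t0 c I X \<longleftrightarrow>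
     (\<forall>t\<in>I. \<forall>i. ((\<lambda>s. X s i) has_real_derivative inf_mat_vec A (X t) i + b t i) (at t)) \<and>
     X t0 = c"

text \<open>The relations on \<open>I\<close> that determine the family \<open>x\<^sub>0, x\<^sub>1, x\<^sub>2, \<dots>\<close> from \<open>y\<close>, with \<open>x\<^sub>j\<close> written as
  \<open>\<lambda>t. X t j\<close>.\<close>

definition generated_family ::
  "(nat \<Rightarrow> nat \<Rightarrow> real) \<Rightarrow> (real \<Rightarrow> real) \<Rightarrow> (real \<Rightarrow> real) \<Rightarrow> (real \<Rightarrow> real) \<Rightarrow> real set
     \<Rightarrow> (real \<Rightarrow> nat \<Rightarrow> real) \<Rightarrow> bool" where
  "generated_family a \<phi> g y I X \<longleftrightarrow>
     (\<forall>t\<in>I.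
        X t 0 = y t \<and>
        ((\<lambda>s. X s 0) has_real_derivative \<phi> (y t) + g t) (at t) \<and>
        \<phi> (y t) + g t = a 0 1 * X t 1 + g t \<and>
        (\<forall>j\<ge>1. ((\<lambda>s. X s j) has_real_derivative a j (j + 1) * X t (j + 1)) (at t)))"

end

theory Submission
  imports Defs
begin

text \<open>Away from row \<open>0\<close> the system only says that \<open>x\<^sub>j\<^sub>+\<^sub>1\<close> is the derivative of \<open>x\<^sub>j\<close> divided by the
  nonzero number \<open>a\<^sub>j\<^sub>,\<^sub>j\<^sub>+\<^sub>1\<close>, while row \<open>0\<close> says that \<open>a\<^sub>0\<^sub>1 x\<^sub>1 = \<phi> \<circ> y\<close>. So everything is determined by
  \<open>x\<^sub>0 = y\<close> and \<open>\<phi> \<circ> y\<close>: dividing by the superdiagonal entries one after another gives uniqueness of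
  the family (\<open>generated_family_unique\<close>).

  For existence, the Taylor series of \<open>\<phi> \<circ> y\<close> converges on the whole interval, hence so do all its
  termwise derivatives, and they represent the derivatives there. Each differentiation
  drops one leading factor of the products in the coefficients and shifts the index of \<open>c\<close>
  (\<open>diffs_chain_coeff\<close>), so the power series \<open>chain_series\<close> with the resulting
  coefficients satisfy the required relations (\<open>chain_series_deriv\<close>), and the \<open>j\<close>-th of
  them has constant term \<open>c\<^sub>j\<close>.

  By uniqueness every family obeying the relations consists of \<open>y\<close> and these series, so its value at
  \<open>t\<^sub>0\<close> is \<open>c\<close>, where \<open>y(t\<^sub>0) = y\<^sub>0 = c\<^sub>0\<close> accounts for the component \<open>0\<close>; and the
  relations are the rows of \<open>X' = A X + b\<close>, because each row of \<open>A\<close> has a single nonzero entry.\<close>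

text \<open>The \<open>n\<close>-th Taylor coefficient at \<open>t\<^sub>0\<close> of the component \<open>x\<^sub>j\<close>, where \<open>j \<ge> 1\<close>: if
  \<open>x\<^sub>j' = a\<^sub>j\<^sub>,\<^sub>j\<^sub>+\<^sub>1 x\<^sub>j\<^sub>+\<^sub>1\<close> for all such \<open>j\<close>, then \<open>x\<^sub>j\<close> differentiated \<open>n\<close> times is the product below times
  \<open>x\<^sub>j\<^sub>+\<^sub>n\<close>. The component \<open>x\<^sub>0\<close> is not of this form, because of the forcing term \<open>g\<close>.\<close>

definition chain_coeff :: "(nat \<Rightarrow> nat \<Rightarrow> real) \<Rightarrow> (nat \<Rightarrow> real) \<Rightarrow> nat \<Rightarrow> nat \<Rightarrow> real" where
  "chain_coeff a c j n = (\<Prod>k=j..<j + n. a k (k + 1)) * c (j + n) / fact n"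

definition chain_series ::
  "(nat \<Rightarrow> nat \<Rightarrow> real) \<Rightarrow> (nat \<Rightarrow> real) \<Rightarrow> nat \<Rightarrow> real \<Rightarrow> real" where
  "chain_series a c j s = (\<Sum>n. chain_coeff a c j n * s ^ n)"

lemma diffs_chain_coeff:
  "diffs (chain_coeff a c j) = (\<lambda>n. a j (j + 1) * chain_coeff a c (j + 1) n)"
proof
  fix n
  have "(\<Prod>k=j..<j + Suc n. a k (k + 1)) = a j (j + 1) * (\<Prod>k=Suc j..<j + Suc n. a k (k + 1))"
    by (subst prod.atLeast_Suc_lessThan) auto
  then have "chain_coeff a c j (Suc n) =
      a j (j + 1) * (\<Prod>k=Suc j..<Suc j + n. a k (k + 1)) * c (Suc j + n) / fact (Suc n)"
    by (simp add: chain_coeff_def)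
  then show "diffs (chain_coeff a c j) n = a j (j + 1) * chain_coeff a c (j + 1) n"
    by (simp add: diffs_def chain_coeff_def field_simps del: of_nat_Suc)
qed

lemma chain_series_at_0: "chain_series a c j 0 = c j"
  unfolding chain_series_def powser_zero by (simp add: chain_coeff_def)

text \<open>A power series and its termwise derivative have the same disc of convergence, so the
  convergence of the first series propagates to the whole chain; dividing by the superdiagonal
  entry recovers the next series from the termwise derivative.\<close>

lemma chain_coeff_summable:
  assumes nz: "\<And>j. a j (j + 1) \<noteq> 0"
    and base: "\<And>s. \<bar>s\<bar> < \<delta> \<Longrightarrow> summable (\<lambda>n. chain_coeff a c 1 n * s ^ n)"
    and "j \<ge> 1" "\<bar>s\<bar> < \<delta>"
  shows "summable (\<lambda>n. chain_coeff a c j n * s ^ n)"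
  using \<open>j \<ge> 1\<close> \<open>\<bar>s\<bar> < \<delta>\<close>
proof (induction j arbitrary: s rule: dec_induct)
  case base
  then show ?case by (rule assms(2))
next
  case (step j)
  have "summable (\<lambda>n. diffs (chain_coeff a c j) n * s ^ n)"
    by (rule termdiff_converges[where K = \<delta>]) (use step in auto)
  then have "summable (\<lambda>n. a j (j + 1) * (chain_coeff a c (j + 1) n * s ^ n))"
    by (simp add: diffs_chain_coeff mult.assoc)
  then show ?case
    using nz[of j] by (simp add: summable_cmult_iff)
qed

lemma chain_series_deriv:
  assumes nz: "\<And>j. a j (j + 1) \<noteq> 0"
    and base: "\<And>s. \<bar>s\<bar> < \<delta> \<Longrightarrow> summable (\<lambda>n. chain_coeff a c 1 n * s ^ n)"
    and j: "j \<ge> 1" and s: "\<bar>s\<bar> < \<delta>"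
  shows "(chain_series a c j has_real_derivative a j (j + 1) * chain_series a c (j + 1) s) (at s)"
proof -
  have "((\<lambda>s. \<Sum>n. chain_coeff a c j n * s ^ n) has_real_derivative
      (\<Sum>n. diffs (chain_coeff a c j) n * s ^ n)) (at s)"
    by (rule termdiffs_strong'[where K = \<delta>]) (use chain_coeff_summable[OF nz base j] s in auto)
  moreover have "(\<Sum>n. diffs (chain_coeff a c j) n * s ^ n) =
      a j (j + 1) * chain_series a c (j + 1) s"
    unfolding chain_series_def diffs_chain_coeff mult.assoc
    by (rule suminf_mult) (use chain_coeff_summable[OF nz base _ s] in simp)
  ultimately show ?thesis
    unfolding chain_series_def[abs_def] by simp
qed

text \<open>The relation for \<open>x\<^sub>0'\<close> fixes \<open>a\<^sub>0\<^sub>1 x\<^sub>1\<close> pointwise. From then on, two families whose \<open>j\<close>-th components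
  agree on the open set \<open>I\<close> have equal derivatives there, so their next components agree as well.\<close>

lemma generated_family_unique:
  assumes nz: "\<And>j. a j (j + 1) \<noteq> 0" and "open I"
    and X: "generated_family a \<phi> g y I X" and Z: "generated_family a \<phi> g y I Z"
    and "t \<in> I"
  shows "Z t j = X t j"
proof (cases "j = 0")
  case True
  then show ?thesis using X Z \<open>t \<in> I\<close> by (simp add: generated_family_def)
next
  case False
  then have "1 \<le> j" by simp
  then show ?thesis
    using \<open>t \<in> I\<close>
  proof (induction j arbitrary: t rule: dec_induct)
    case base
    then have "a 0 1 * Z t 1 = a 0 1 * X t 1"
      using X Z by (auto simp: generated_family_def)
    then show ?case using nz[of 0] by simp
  next
    case (step j)
    have "((\<lambda>s. X s j) has_real_derivative a j (j + 1) * X t (j + 1)) (at t)"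
      and dZ: "((\<lambda>s. Z s j) has_real_derivative a j (j + 1) * Z t (j + 1)) (at t)"
      using X Z step by (auto simp: generated_family_def)
    then have "((\<lambda>s. Z s j) has_real_derivative a j (j + 1) * X t (j + 1)) (at t)"
      using step by (auto intro: has_field_derivative_transform_within_open[OF _ \<open>open I\<close>])
    with dZ have "a j (j + 1) * Z t (j + 1) = a j (j + 1) * X t (j + 1)"
      by (rule DERIV_unique)
    then show ?case using nz[of j] by simp
  qed
qed

lemma inf_mat_vec_superdiagonal:
  assumes "\<And>i j. j \<noteq> i + 1 \<Longrightarrow> a i j = 0"
  shows "inf_mat_vec a v i = a i (i + 1) * v (i + 1)"
proof -
  have "(\<Sum>k. a i k * v k) = (\<Sum>k\<in>{i + 1}. a i k * v k)"
    by (rule suminf_finite) (use assms in auto)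
  then show ?thesis by (simp add: inf_mat_vec_def)
qed

lemma generated_family_solves:
  assumes "\<And>i j. j \<noteq> i + 1 \<Longrightarrow> a i j = 0"
    and X: "generated_family a \<phi> g y I X" and "X t0 = c"
  shows "solves_infinite_linear_ivp a (forcing_vec g) t0 c I X"
  unfolding solves_infinite_linear_ivp_def
proof (intro conjI ballI allI)
  fix t i assume "t \<in> I"
  then show "((\<lambda>s. X s i) has_real_derivative inf_mat_vec a (X t) i + forcing_vec g t i) (at t)"
    using X by (cases "i = 0")
      (auto simp: generated_family_def inf_mat_vec_superdiagonal[OF assms(1)] forcing_vec_def)
qed (fact \<open>X t0 = c\<close>)

theorem theorem3p2:
  fixes t0 y0 \<delta> :: real
    and a :: "nat \<Rightarrow> nat \<Rightarrow> real"
    and c :: "nat \<Rightarrow> real"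
    and g \<phi> y :: "real \<Rightarrow> real"
  assumes superdiag_nz: "\<And>j. a j (j + 1) \<noteq> 0"
    and off_superdiag: "\<And>i j. j \<noteq> i + 1 \<Longrightarrow> a i j = 0"
    and c0: "c 0 = y0"
    and g_smooth: "infinitely_differentiable_at g t0"
    and delta_pos: "\<delta> > 0"
    and ode: "\<And>t. \<bar>t - t0\<bar> < \<delta> \<Longrightarrow> (y has_real_derivative \<phi> (y t) + g t) (at t)"
    and init: "y t0 = y0"
    and taylor: "\<And>t. \<bar>t - t0\<bar> < \<delta> \<Longrightarrow>
      (\<lambda>n. (\<Prod>k=0..n. a k (k + 1)) * c (n + 1) * ((t - t0) ^ n / fact n)) sums \<phi> (y t)"
  shows "(\<exists>X. generated_family a \<phi> g y {t. \<bar>t - t0\<bar> < \<delta>} X \<and>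
             (\<forall>Z. generated_family a \<phi> g y {t. \<bar>t - t0\<bar> < \<delta>} Z \<longrightarrow>
                  (\<forall>t. \<bar>t - t0\<bar> < \<delta> \<longrightarrow> Z t = X t))) \<and>
         (\<forall>X. generated_family a \<phi> g y {t. \<bar>t - t0\<bar> < \<delta>} X \<longrightarrow>
             solves_infinite_linear_ivp a (forcing_vec g) t0 c {t. \<bar>t - t0\<bar> < \<delta>} X)"
proof -
  define I where "I = {t. \<bar>t - t0\<bar> < \<delta>}"
  have "I = ball t0 \<delta>"
    by (auto simp: I_def dist_real_def abs_minus_commute)
  then have "open I" by simp
  have "t0 \<in> I" using delta_pos by (simp add: I_def)

  have phi_sums: "(\<lambda>n. a 0 1 * (chain_coeff a c 1 n * s ^ n)) sums \<phi> (y (t0 + s))"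
    if "\<bar>s\<bar> < \<delta>" for s
  proof -
    have "(\<Prod>k=0..n. a k (k + 1)) = a 0 1 * (\<Prod>k=1..<1 + n. a k (k + 1))" for n
      by (simp add: prod.atLeast_Suc_lessThan flip: atLeastLessThanSuc_atLeastAtMost)
    then have "(\<Prod>k=0..n. a k (k + 1)) * c (n + 1) * (s ^ n / fact n) =
        a 0 1 * (chain_coeff a c 1 n * s ^ n)" for n
      by (simp add: chain_coeff_def add.commute)
    then show ?thesis using taylor[of "t0 + s"] that by simp
  qed
  have base: "summable (\<lambda>n. chain_coeff a c 1 n * s ^ n)" if "\<bar>s\<bar> < \<delta>" for s
    using sums_summable[OF phi_sums[OF that]] superdiag_nz[of 0] by (simp add: summable_cmult_iff)
  have phi_eq: "\<phi> (y t) = a 0 1 * chain_series a c 1 (t - t0)" if "t \<in> I" for t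
  proof -
    have s: "\<bar>t - t0\<bar> < \<delta>" using that by (simp add: I_def)
    show ?thesis
      using sums_unique[OF phi_sums[OF s]] suminf_mult[OF base[OF s], of "a 0 1"]
      by (simp add: chain_series_def)
  qed

  define X where "X t j = (if j = 0 then y t else chain_series a c j (t - t0))" for t j
  have X: "generated_family a \<phi> g y I X"
    unfolding generated_family_def
  proof (intro ballI conjI allI impI)
    fix t assume t: "t \<in> I"
    show "X t 0 = y t" by (simp add: X_def)
    show "((\<lambda>s. X s 0) has_real_derivative \<phi> (y t) + g t) (at t)"
      using ode t by (simp add: X_def I_def)
    show "\<phi> (y t) + g t = a 0 1 * X t 1 + g t"
      using phi_eq[OF t] by (simp add: X_def)
    fix j :: nat assume j: "1 \<le> j"
    have "(chain_series a c j has_real_derivative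
        a j (j + 1) * chain_series a c (j + 1) (t - t0)) (at (t - t0))"
      by (rule chain_series_deriv[OF superdiag_nz base j]) (use t in \<open>simp_all add: I_def\<close>)
    then have "((\<lambda>s. chain_series a c j (s - t0)) has_real_derivative
        a j (j + 1) * chain_series a c (j + 1) (t - t0)) (at t)"
      using DERIV_shift[of "chain_series a c j" _ t "- t0"] by simp
    then show "((\<lambda>s. X s j) has_real_derivative a j (j + 1) * X t (j + 1)) (at t)"
      using j by (simp add: X_def)
  qed

  have unique: "Z t = X t" if "generated_family a \<phi> g y I Z" "t \<in> I" for Z t
    using generated_family_unique[OF superdiag_nz \<open>open I\<close> X that] by auto
  have "X t0 = c"
    using init c0 by (auto simp: X_def chain_series_at_0)
  then have "solves_infinite_linear_ivp a (forcing_vec g) t0 c I Z"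
    if "generated_family a \<phi> g y I Z" for Z
    using generated_family_solves[OF off_superdiag that, of t0 c] unique[OF that \<open>t0 \<in> I\<close>] by simp
  with X unique show ?thesis
    unfolding I_def by blast
qed

end
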